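(* Let $k$ be a positive integer and let $D$ be a digraph with a partition $\{X,Y\}$ of $V(D)$ such that $D[X]$ is traceable and $Y$ is a stable set of $D$. Suppose that either $|X|<k$, or there is a set $S\subseteq X$ with $|S|=k$ such that no vertex $y\in Y$ is adjacent to every vertex of $S$. Then $\pi_k(D)\leq \alpha_k(D)$.
   Context: Digraphs have no loops and no parallel arcs (directed 2-cycles are allowed). Paths are directed paths; the size $|P|$ of a path $P$ is its number of vertices. A digraph is traceable if it has a Hamiltonian path. A stable set of $D$ is a stable set of its underlying undirected graph; two vertices $u,v$ are adjacent if $(u,v)\in A(D)$ or $(v,u)\in A(D)$. A path partition of $D$ is a set of vertex-disjoint paths covering $V(D)$. The $k$-norm of a path partition $\mathcal{P}$ is $|\mathcal{P}|_k=\sum_{P\in\mathcal{P}}\min\{|P|,k\}$, and $\pi_k(D)$ is the minimum $k$-norm over all path partitions of $D$. A $k$-partial coloring is a set of $k$ pairwise disjoint stable sets (empty allowed); its weight is the sum of the sizes of its classes, and $\alpha_k(D)$ is the maximum weight of a $k$-partial coloring of $D$. *)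

theory Defs
  imports "Graph_Theory.Graph_Theory" "HOL-Library.Disjoint_Sets"
begin

definition adjacent :: "('a, 'b) pre_digraph \<Rightarrow> 'a \<Rightarrow> 'a \<Rightarrow> bool" where
  "adjacent D u v \<longleftrightarrow> u \<rightarrow>\<^bsub>D\<^esub> v \<or> v \<rightarrow>\<^bsub>D\<^esub> u"

definition stable_set :: "('a, 'b) pre_digraph \<Rightarrow> 'a set \<Rightarrow> bool" where
  "stable_set D S \<longleftrightarrow> S \<subseteq> verts D \<and> (\<forall>u\<in>S. \<forall>v\<in>S. \<not> adjacent D u v)"

(* A vpath is a nonempty list of distinct vertices, consecutive ones joined by arcs;
   without parallel arcs this list determines the path, and its length is the size of the path. *)

definition traceable :: "('a, 'b) pre_digraph \<Rightarrow> bool" where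
  "traceable D \<longleftrightarrow> (\<exists>p. vpath p D \<and> set p = verts D)"

definition path_partition :: "('a, 'b) pre_digraph \<Rightarrow> 'a list set \<Rightarrow> bool" where
  "path_partition D P \<longleftrightarrow>
     (\<forall>p\<in>P. vpath p D) \<and> disjoint_family_on set P \<and> (\<Union>p\<in>P. set p) = verts D"

definition path_norm :: "nat \<Rightarrow> 'a list set \<Rightarrow> nat" where
  "path_norm k P = (\<Sum>p\<in>P. min (length p) k)"

definition pi_k :: "nat \<Rightarrow> ('a, 'b) pre_digraph \<Rightarrow> nat" where
  "pi_k k D = Min {path_norm k P | P. path_partition D P}"

(* The k classes are indexed by 0, ..., k-1, so that the empty class may occur repeatedly;
   the values of C outside this range are irrelevant. *)

definition partial_coloring :: "nat \<Rightarrow> ('a, 'b) pre_digraph \<Rightarrow> (nat \<Rightarrow> 'a set) \<Rightarrow> bool" where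
  "partial_coloring k D C \<longleftrightarrow>
     (\<forall>i<k. stable_set D (C i)) \<and> disjoint_family_on C {..<k}"

definition coloring_weight :: "nat \<Rightarrow> (nat \<Rightarrow> 'a set) \<Rightarrow> nat" where
  "coloring_weight k C = (\<Sum>i<k. card (C i))"

definition alpha_k :: "nat \<Rightarrow> ('a, 'b) pre_digraph \<Rightarrow> nat" where
  "alpha_k k D = Max {coloring_weight k C | C. partial_coloring k D C}"

text \<open>In a finite digraph, the minimum and the maximum above range over finite nonempty sets.\<close>

lemma path_norms_finite_nonempty:
  assumes "digraph D"
  shows "finite {path_norm k P | P. path_partition D P}"
    and "{path_norm k P | P. path_partition D P} \<noteq> {}"
proof -
  interpret digraph D by fact
  have fin: "finite {p. set p \<subseteq> verts D \<and> distinct p}"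
    by (rule finite_subset_distinct) simp
  have "{P. path_partition D P} \<subseteq> Pow {p. set p \<subseteq> verts D \<and> distinct p}"
    by (auto simp: path_partition_def vpath_def vwalk_def)
  then have "finite {P. path_partition D P}"
    using fin by (meson finite_Pow_iff finite_subset)
  then show "finite {path_norm k P | P. path_partition D P}"
    by simp
  have "path_partition D ((\<lambda>v. [v]) ` verts D)"
    by (auto simp: path_partition_def vpath_def vwalk_def disjoint_family_on_def)
  then show "{path_norm k P | P. path_partition D P} \<noteq> {}"
    by blast
qed

lemma coloring_weights_finite_nonempty:
  assumes "digraph D"
  shows "finite {coloring_weight k C | C. partial_coloring k D C}"
    and "{coloring_weight k C | C. partial_coloring k D C} \<noteq> {}"
proof -
  interpret digraph D by fact
  have "coloring_weight k C \<le> (\<Sum>i<k. card (verts D))" if "partial_coloring k D C" for C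
    unfolding coloring_weight_def
    using that by (intro sum_mono card_mono) (auto simp: partial_coloring_def stable_set_def)
  then show "finite {coloring_weight k C | C. partial_coloring k D C}"
    by (intro finite_subset[OF _ finite_atMost[of "\<Sum>i<k. card (verts D)"]]) auto
  have "partial_coloring k D (\<lambda>_. {})"
    by (auto simp: partial_coloring_def stable_set_def disjoint_family_on_def)
  then show "{coloring_weight k C | C. partial_coloring k D C} \<noteq> {}"
    by blast
qed

end

(* A Hamiltonian path of D[X] together with the single vertices of Y is a path partition of norm
   at most min (card X) k + card Y. If card X < k, giving every vertex of X its own color and Y one
   more color reaches this weight. Otherwise give every vertex of S its own color, and every y in Y
   the color of some vertex of S that is not adjacent to y. *)
theory Submission
  imports Defs
begin

lemma pi_k_le_path_norm:
  assumes "digraph D" and "path_partition D P"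
  shows "pi_k k D \<le> path_norm k P"
  unfolding pi_k_def using assms by (intro Min_le path_norms_finite_nonempty(1)) auto

text \<open>An injection of the color set \<open>I\<close> into \<open>{..<k}\<close> turns the
  fibres of \<open>c\<close> into indexed classes. The type of colors is left free so that vertices,
  or an option type over them, can serve as colors.\<close>

lemma card_le_alpha_k:
  fixes c :: "'a \<Rightarrow> 'c"
  assumes D: "digraph D" and A: "A \<subseteq> verts D"
    and I: "finite I" "card I \<le> k" "c ` A \<subseteq> I"
    and proper: "\<And>u v. u \<in> A \<Longrightarrow> v \<in> A \<Longrightarrow> adjacent D u v \<Longrightarrow> c u \<noteq> c v"
  shows "card A \<le> alpha_k k D"
proof -
  interpret digraph D by fact
  obtain f where f: "f ` I \<subseteq> {..<k}" "inj_on f I"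
    using card_le_inj[of I "{..<k}"] I by auto
  \<comment> \<open>An index that \<open>f\<close> does not use gets the empty class, so fewer than
    \<open>k\<close> colors are harmless.\<close>
  define C where "C i = {v \<in> A. f (c v) = i}" for i
  have "\<not> adjacent D u v" if "u \<in> C i" "v \<in> C i" for i u v
  proof -
    have "u \<in> A" "v \<in> A" "f (c u) = f (c v)"
      using that by (auto simp: C_def)
    moreover from this have "c u = c v"
      using f(2) I(3) by (blast dest: inj_onD)
    ultimately show ?thesis
      using proper by blast
  qed
  then have "stable_set D (C i)" for i
    using A by (auto simp: stable_set_def C_def)
  then have col: "partial_coloring k D C"
    by (auto simp: partial_coloring_def disjoint_family_on_def C_def)
  have "finite A"
    using A by (rule finite_subset) simp
  then have "card (\<Union>i<k. C i) = coloring_weight k C"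
    unfolding coloring_weight_def by (intro card_UN_disjoint) (auto simp: C_def)
  moreover have "f (c v) < k" if "v \<in> A" for v
    using that f(1) I(3) by (meson imageI lessThan_iff subset_iff)
  then have "A = (\<Union>i<k. C i)"
    by (auto simp: C_def)
  ultimately have "card A = coloring_weight k C"
    by metis
  then show ?thesis
    unfolding alpha_k_def using col D
    by (auto intro!: Max_ge coloring_weights_finite_nonempty(1))
qed

lemma vpath_induce_subgraph:
  assumes "vpath p (D \<restriction> X)" and "X \<subseteq> verts D"
  shows "vpath p D"
proof -
  have "u \<rightarrow>\<^bsub>D\<^esub> v" if "u \<rightarrow>\<^bsub>D \<restriction> X\<^esub> v" for u v
    using that by (auto simp: arcs_ends_def arc_to_ends_def)
  then show ?thesis
    using assms by (auto simp: vpath_def vwalk_def)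
qed

lemma path_partition_path_and_singletons:
  assumes "vpath p D" and "set p \<inter> Y = {}" and "set p \<union> Y = verts D"
  shows "path_partition D (insert p ((\<lambda>y. [y]) ` Y))"
  using assms by (auto simp: path_partition_def disjoint_family_on_def vpath_def vwalk_def)

text \<open>A one-vertex path contributes \<open>min 1 k\<close>, hence at most 1. Equality can
  fail, for instance when \<open>p\<close> is itself one of the singletons and is counted
  once.\<close>

lemma path_norm_insert_singletons_le:
  assumes "finite Y"
  shows "path_norm k (insert p ((\<lambda>y. [y]) ` Y)) \<le> min (length p) k + card Y"
proof -
  have "path_norm k (insert p ((\<lambda>y. [y]) ` Y)) \<le> min (length p) k + path_norm k ((\<lambda>y. [y]) ` Y)"
    using assms by (simp add: path_norm_def sum.insert_if)
  also have "path_norm k ((\<lambda>y. [y]) ` Y) \<le> card Y"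
    by (simp add: path_norm_def sum.reindex inj_on_def)
  finally show ?thesis by simp
qed

theorem theorem1:
  fixes D :: "('a, 'b) pre_digraph" and X Y :: "'a set" and k :: nat
  assumes "digraph D"
    and "k > 0"
    and "X \<union> Y = verts D" and "X \<inter> Y = {}"
    and "traceable (D \<restriction> X)"
    and "stable_set D Y"
    and "card X < k \<or>
         (\<exists>S\<subseteq>X. card S = k \<and> \<not> (\<exists>y\<in>Y. \<forall>s\<in>S. adjacent D y s))"
  shows "pi_k k D \<le> alpha_k k D"
proof -
  interpret digraph D by fact
  have fin: "finite X" "finite Y"
    using assms(3) finite_verts by (metis finite_Un)+
  have loopfree: "\<not> adjacent D v v" for v
    by (auto simp: adjacent_def dest: adj_not_same)
  have Y: "\<not> adjacent D u v" if "u \<in> Y" "v \<in> Y" for u v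
    using assms(6) that by (auto simp: stable_set_def)
  obtain p where p: "vpath p (D \<restriction> X)" "set p = X"
    using assms(5) by (auto simp: traceable_def)
  have "vpath p D"
    using p(1) assms(3) by (auto intro: vpath_induce_subgraph)
  then have "pi_k k D \<le> path_norm k (insert p ((\<lambda>y. [y]) ` Y))"
    using p(2) assms(3,4) by (intro pi_k_le_path_norm path_partition_path_and_singletons assms(1)) auto
  also have "\<dots> \<le> min (length p) k + card Y"
    using fin(2) by (rule path_norm_insert_singletons_le)
  also have "length p = card X"
    using p by (auto simp: vpath_def distinct_card[symmetric])
  finally have pi: "pi_k k D \<le> min (card X) k + card Y" .
  show ?thesis
    using assms(7)
  proof
    assume less: "card X < k"
    \<comment> \<open>\<open>None\<close> is the color shared by all of \<open>Y\<close>; together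
      with one color per vertex of \<open>X\<close> this makes at most \<open>card X + 1\<close>
      colors, which is where strictness of \<open>card X < k\<close> enters.\<close>
    define c where "c v = (if v \<in> X then Some v else None)" for v
    have "card (X \<union> Y) \<le> alpha_k k D"
    proof (rule card_le_alpha_k[OF assms(1), where I = "insert None (Some ` X)" and c = c])
      show "card (insert None (Some ` X)) \<le> k"
        using less fin(1) by (simp add: card_image card_insert_if)
      \<comment> \<open>Equal colors force \<open>u = v\<close> or both vertices in
        \<open>Y\<close>.\<close>
      show "c u \<noteq> c v" if "u \<in> X \<union> Y" "v \<in> X \<union> Y" "adjacent D u v" for u v
        using that loopfree Y by (auto simp: c_def)
    qed (use assms(3) fin(1) in \<open>auto simp: c_def\<close>)
    then show ?thesis
      using pi less fin assms(4) by (simp add: card_Un_disjoint)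
  next
    assume "\<exists>S\<subseteq>X. card S = k \<and> \<not> (\<exists>y\<in>Y. \<forall>s\<in>S. adjacent D y s)"
    then obtain S where S: "S \<subseteq> X" "card S = k"
      and nonadj: "\<not> (\<exists>y\<in>Y. \<forall>s\<in>S. adjacent D y s)"
      by (elim exE conjE)
    have "\<forall>y\<in>Y. \<exists>s. s \<in> S \<and> \<not> adjacent D y s"
      using nonadj by (simp add: Bex_def)
    from bchoice[OF this] obtain g where g: "\<forall>y\<in>Y. g y \<in> S \<and> \<not> adjacent D y (g y)" ..
    \<comment> \<open>The \<open>k\<close> vertices of \<open>S\<close> are themselves the colors;
      vertices of \<open>X\<close> outside \<open>S\<close> stay uncolored.\<close>
    define c where "c v = (if v \<in> S then v else g v)" for v
    have "card (S \<union> Y) \<le> alpha_k k D"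
    proof (rule card_le_alpha_k[OF assms(1), where I = S and c = c])
      show "c u \<noteq> c v" if "u \<in> S \<union> Y" "v \<in> S \<union> Y" "adjacent D u v" for u v
      proof -
        \<comment> \<open>The choice of \<open>g\<close> excludes adjacency only with the vertex of
          \<open>Y\<close> first, while here either of \<open>u\<close> and \<open>v\<close> may be
          the one in \<open>Y\<close>.\<close>
        have "adjacent D v u"
          using that(3) by (auto simp: adjacent_def)
        then show ?thesis
          using that g loopfree Y by (auto simp: c_def)
      qed
      show "finite S"
        using S(1) fin(1) by (rule finite_subset)
    qed (use S g assms(3) in \<open>auto simp: c_def\<close>)
    moreover have "card (S \<union> Y) = k + card Y"
      using S fin assms(4) by (subst card_Un_disjoint) (auto intro: finite_subset)
    \<comment> \<open>The uncolored vertices cost nothing, since the Hamiltonian path of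
      \<open>X\<close> contributes at most \<open>k\<close> to the norm.\<close>
    ultimately show ?thesis
      using pi by linarith
  qed
qed

end
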